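(* Let $P$ be a finite poset with elements $\alpha_1,\dots,\alpha_p$ labeled so that $\alpha_i<\alpha_j$ implies $i<j$, with a unique maximal element $\hat 1$, and let $C: t_1<\cdots<t_n=\hat 1$ be a chain in $P$. Let $x_1,\dots,x_n>0$ be real and $u_i=x_1+\cdots+x_i$, $u=(u_1,\dots,u_n)$. For each linear extension $\pi=a_1\cdots a_p\in\mathcal{L}(P)$ let $\Lambda_\pi$ be the set of $f\in\mathcal{C}_C(P,u)$ whose extension to $P$ by $f(t_i)=u_i$ satisfies $$0\le f(\alpha_{a_1})\le f(\alpha_{a_2})\le\cdots\le f(\alpha_{a_p}).$$ Then $\Lambda_\pi$ is a product of simplices of dimensions $h_1(\pi)-1,\ h_2(\pi)-h_1(\pi)-1,\ \dots,\ h_n(\pi)-h_{n-1}(\pi)-1$, and $$\mathrm{Vol}(\Lambda_\pi)=\prod_{i=1}^n\frac{x_i^{h_i(\pi)-h_{i-1}(\pi)-1}}{(h_i(\pi)-h_{i-1}(\pi)-1)!}.$$ Moreover, the sets $\Lambda_\pi$, $\pi\in\mathcal{L}(P)$, are the chambers of a polytopal subdivision of $\mathcal{C}_C(P,u)$.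
   Context: A linear extension of $P$ is an order-preserving bijection $\pi:P\to\{1,\dots,p\}$, identified with the word $a_1\cdots a_p$ (a permutation of $\{1,\dots,p\}$) defined by $\pi(\alpha_{a_i})=i$; $\mathcal{L}(P)$ is the set of all linear extensions. The height $h_i(\pi)$ is the position of $t_i$ in $\pi$, i.e. $t_i=\alpha_{a_{h_i(\pi)}}$ (equivalently $h_i(\pi)=\pi(t_i)$), with $h_0(\pi)=0$. The order cone section $\mathcal{C}_C(P,u)\subset\mathbb{R}^{P-C}$ is the convex polytope of all order-preserving maps $f:P-C\to\mathbb{R}_{\ge 0}$ such that the extension of $f$ to $P$ defined by $f(t_i)=u_i$ ($1\le i\le n$) is order-preserving. $\mathrm{Vol}$ is $|P-C|$-dimensional volume in $\mathbb{R}^{P-C}$. A polytopal subdivision of a polytope is a finite collection of polytopes, closed under taking faces, any two of which intersect in a common (possibly empty) face, whose union is the given polytope; its full-dimensional members are its chambers. *)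

theory Defs
  imports "HOL-Analysis.Analysis"
begin

text \<open>
  The poset \<open>P\<close> is a type \<open>'a\<close> of class \<open>{finite, order}\<close>. For \<open>A \<subseteq> P\<close>, the space of real functions
  on \<open>A\<close> is realised as the coordinate subspace of \<open>real^'a\<close> of vectors vanishing outside \<open>A\<close>.
  In this way the library notions of polytope, face, simplex and affine dimension apply, also when
  \<open>A\<close> is empty.
\<close>

definition coord_space :: "'a::finite set \<Rightarrow> (real^'a) set" where
  "coord_space A = {f. \<forall>b. b \<notin> A \<longrightarrow> f $ b = 0}"

definition coord_proj :: "'a::finite set \<Rightarrow> real^'a \<Rightarrow> real^'a" where
  "coord_proj A f = (\<chi> b. if b \<in> A then f $ b else 0)"

text \<open>
  The \<open>card A\<close>-dimensional volume of \<open>S \<subseteq> coord_space A\<close>, taken with respect to the product Lebesgue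
  measure on the functions on \<open>A\<close>; if \<open>A\<close> is empty, this is the unit mass on one point.
\<close>

definition coord_volume :: "'a::finite set \<Rightarrow> (real^'a) set \<Rightarrow> real" where
  "coord_volume A S = measure (Pi\<^sub>M A (\<lambda>_. lborel)) ((\<lambda>f. \<lambda>b\<in>A. f $ b) ` S)"

text \<open>
  The product is the Cartesian one, for a decomposition of the coordinates \<open>A\<close> into blocks
  \<open>B 1, \<dots>, B n\<close> (empty blocks allowed), with \<open>T i\<close> a simplex of dimension \<open>d i\<close> in the space of
  functions on \<open>B i\<close>.
\<close>

definition product_of_simplices ::
    "'a::finite set \<Rightarrow> nat \<Rightarrow> (nat \<Rightarrow> nat) \<Rightarrow> (real^'a) set \<Rightarrow> bool" where
  "product_of_simplices A n d S \<longleftrightarrow>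
     (\<exists>B T. disjoint_family_on B {1..n} \<and> (\<Union>i\<in>{1..n}. B i) = A \<and>
        (\<forall>i\<in>{1..n}. T i \<subseteq> coord_space (B i) \<and> int (d i) simplex T i) \<and>
        S = {f \<in> coord_space A. \<forall>i\<in>{1..n}. coord_proj (B i) f \<in> T i})"

definition polytopal_subdivision :: "'v::euclidean_space set set \<Rightarrow> 'v set \<Rightarrow> bool" where
  "polytopal_subdivision K S \<longleftrightarrow>
     polytope S \<and> finite K \<and> (\<forall>X\<in>K. polytope X) \<and>
     (\<forall>X\<in>K. \<forall>F. F face_of X \<longrightarrow> F \<in> K) \<and>
     (\<forall>X\<in>K. \<forall>Y\<in>K. X \<inter> Y face_of X \<and> X \<inter> Y face_of Y) \<and>
     \<Union>K = S"

definition chambers :: "'v::euclidean_space set set \<Rightarrow> 'v set \<Rightarrow> 'v set set" where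
  "chambers K S = {X \<in> K. aff_dim X = aff_dim S}"

definition natural_labeling :: "nat \<Rightarrow> (nat \<Rightarrow> 'a::{finite,order}) \<Rightarrow> bool" where
  "natural_labeling p \<alpha> \<longleftrightarrow>
     bij_betw \<alpha> {1..p} UNIV \<and> (\<forall>i\<in>{1..p}. \<forall>j\<in>{1..p}. \<alpha> i < \<alpha> j \<longrightarrow> i < j)"

definition linear_extensions :: "nat \<Rightarrow> ('a::{finite,order} \<Rightarrow> nat) set" where
  "linear_extensions p = {\<pi>. bij_betw \<pi> UNIV {1..p} \<and> mono \<pi>}"

text \<open>The letter \<open>a\<^sub>i\<close> of the word \<open>a\<^sub>1\<dots>a\<^sub>p\<close> identified with the linear extension \<open>\<pi>\<close>.\<close>

definition letter :: "nat \<Rightarrow> (nat \<Rightarrow> 'a::{finite,order}) \<Rightarrow> ('a \<Rightarrow> nat) \<Rightarrow> nat \<Rightarrow> nat" where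
  "letter p \<alpha> \<pi> i = (THE j. j \<in> {1..p} \<and> \<pi> (\<alpha> j) = i)"

definition height :: "(nat \<Rightarrow> 'a) \<Rightarrow> ('a \<Rightarrow> nat) \<Rightarrow> nat \<Rightarrow> nat" where
  "height t \<pi> i = (if i = 0 then 0 else \<pi> (t i))"

text \<open>A chain \<open>C: t\<^sub>1 < \<dots> < t\<^sub>n\<close> is given by \<open>t\<close> on \<open>{1..n}\<close>, so that \<open>P - C\<close> is \<open>- t ` {1..n}\<close>.\<close>

definition extend_by ::
    "(nat \<Rightarrow> 'a::finite) \<Rightarrow> nat \<Rightarrow> (nat \<Rightarrow> real) \<Rightarrow> real^'a \<Rightarrow> 'a \<Rightarrow> real" where
  "extend_by t n u f b = (if b \<in> t ` {1..n} then u (inv_into {1..n} t b) else f $ b)"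

definition order_cone_section ::
    "(nat \<Rightarrow> 'a::{finite,order}) \<Rightarrow> nat \<Rightarrow> (nat \<Rightarrow> real) \<Rightarrow> (real^'a::{finite,order}) set" where
  "order_cone_section t n u =
     {f \<in> coord_space (- t ` {1..n}).
        (\<forall>b \<in> - t ` {1..n}. 0 \<le> f $ b) \<and>
        mono_on (- t ` {1..n}) (\<lambda>b. f $ b) \<and>
        mono (extend_by t n u f)}"

definition Lambda_cell ::
    "nat \<Rightarrow> (nat \<Rightarrow> 'a::{finite,order}) \<Rightarrow> (nat \<Rightarrow> 'a) \<Rightarrow> nat \<Rightarrow> (nat \<Rightarrow> real) \<Rightarrow> ('a \<Rightarrow> nat)
       \<Rightarrow> (real^'a::{finite,order}) set" where
  "Lambda_cell p \<alpha> t n u \<pi> =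
     {f \<in> order_cone_section t n u.
        0 \<le> extend_by t n u f (\<alpha> (letter p \<alpha> \<pi> 1)) \<and>
        (\<forall>i\<in>{1..<p}. extend_by t n u f (\<alpha> (letter p \<alpha> \<pi> i))
                      \<le> extend_by t n u f (\<alpha> (letter p \<alpha> \<pi> (Suc i))))}"

end

theory Submission
  imports Defs
begin

text \<open>
  Along a fixed linear extension \<open>\<pi>\<close>, the heights of the chain elements cut the word into blocks.
  On the \<open>i\<close>-th block the inequalities defining \<open>\<Lambda>\<^sub>\<pi>\<close> say that the values of \<open>f\<close> increase along the
  word inside the interval from \<open>u\<^sub>i - x\<^sub>i\<close> to \<open>u\<^sub>i\<close>, and there is no further condition relating
  different blocks; hence \<open>\<Lambda>\<^sub>\<pi>\<close> is a product of order simplices. The volume of an order simplex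
  follows by integrating over its largest coordinate. Two cells meet where the values on every pair
  of elements that the two words order differently coincide, and each such equality cuts out
  a face. Sorting the elements by their values, ties being broken by label, shows
  that the cells cover the section.
\<close>

subsection \<open>Coordinate subspaces and order simplices\<close>

lemma subspace_coord_space: "subspace (coord_space A)"
  by (auto simp: coord_space_def subspace_def)

lemma coord_proj_in_coord_space: "coord_proj A f \<in> coord_space A"
  by (simp add: coord_proj_def coord_space_def)

lemma continuous_on_coord_proj: "continuous_on S (coord_proj A)"
proof -
  have *: "continuous_on S (\<lambda>f. if b \<in> A then f $ b else 0)" for b
    by (cases "b \<in> A") (auto intro!: continuous_intros)
  show ?thesis
    unfolding coord_proj_def by (rule continuous_on_vec_lambda) (rule *)
qed

lemma dim_coord_space: "dim (coord_space A) = card A"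
  using dim_substandard_cart[of A, where ?'a = real]
  by (simp add: coord_space_def dim_vec_eq)

lemma aff_dim_coord_space: "aff_dim (coord_space A) = int (card A)"
  by (simp add: aff_dim_subspace subspace_coord_space dim_coord_space)

text \<open>A nonempty relatively open part of a linear subspace has that whole subspace as its
  affine hull. The lemma yields the dimension of the simplices and later of the cells.\<close>

lemma aff_dim_open_subset:
  assumes "S \<subseteq> coord_space A" "open U" "coord_space A \<inter> U \<subseteq> S" "coord_space A \<inter> U \<noteq> {}"
  shows "aff_dim S = int (card A)"
proof (rule antisym)
  show "aff_dim S \<le> int (card A)"
    using aff_dim_subset[OF assms(1)] by (simp add: aff_dim_coord_space)
  have "affine hull (coord_space A \<inter> U) = coord_space A"
    using assms by (simp add: affine_hull_affine_Int_open subspace_imp_affine subspace_coord_space)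
  then have "aff_dim (coord_space A \<inter> U) = int (card A)"
    by (metis aff_dim_affine_hull aff_dim_coord_space)
  then show "int (card A) \<le> aff_dim S"
    using aff_dim_subset[OF assms(3)] by simp
qed

text \<open>An affine dimension of \<open>d\<close> forces at least \<open>d + 1\<close> points, so
  with at most \<open>Suc d\<close> of them the count is exact and the points are affinely
  independent. Independence of explicit vertices then need not be checked by hand.\<close>

lemma simplexI_aff_dim:
  assumes "S = convex hull C" "finite C" "card C \<le> Suc d" "aff_dim S = int d"
  shows "int d simplex S"
proof -
  have "aff_dim C = int d"
    using assms by (simp add: aff_dim_convex_hull)
  moreover have "aff_dim C \<le> int (card C) - 1"
    using aff_dim_le_card[OF assms(2)] .
  ultimately have "int (card C) = int d + 1" "aff_dim C = int (card C) - 1"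
    using assms(3) by linarith+
  then show ?thesis
    using assms(1,2) by (auto simp: simplex_def affine_independent_iff_card)
qed

section \<open>Order simplices\<close>

text \<open>The bounds are imposed on every coordinate, so an empty \<open>B\<close> is no special
  case: the set is then the single point 0, a simplex of dimension 0.\<close>

definition order_simplex :: "'a::finite set \<Rightarrow> ('a \<Rightarrow> nat) \<Rightarrow> real \<Rightarrow> real \<Rightarrow> (real^'a) set" where
  "order_simplex B \<rho> l r =
     {f \<in> coord_space B. (\<forall>b\<in>B. l \<le> f $ b \<and> f $ b \<le> r) \<and>
        (\<forall>b\<in>B. \<forall>c\<in>B. \<rho> b \<le> \<rho> c \<longrightarrow> f $ b \<le> f $ c)}"

text \<open>The strict forms of the defining inequalities give the open set; it remains to exhibit
  one point that satisfies them all.\<close>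

lemma order_simplex_open_subset:
  assumes "bij_betw \<rho> B {m<..m+d}" "l < r"
  obtains U where "open U" "coord_space B \<inter> U \<noteq> {}" "coord_space B \<inter> U \<subseteq> order_simplex B \<rho> l r"
proof
  let ?U = "{f. \<forall>b\<in>B. l < f $ b} \<inter> {f. \<forall>b\<in>B. f $ b < r} \<inter>
    {f. \<forall>b\<in>B. \<forall>c\<in>{c\<in>B. \<rho> b < \<rho> c}. f $ b < f $ c}"
  have lt: "open {f. \<forall>b\<in>B. P b f}" if "\<And>b. b \<in> B \<Longrightarrow> open {f. P b f}"
    for P :: "'a \<Rightarrow> real^'a \<Rightarrow> bool" and B
    using that by (subst Collect_ball_eq) (rule open_INT, auto)
  show "open ?U"
    by (intro open_Int lt open_Collect_less continuous_intros)
  \<comment> \<open>Equally spaced values in \<open>d + 1\<close> steps: rank \<open>m\<close> would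
    give \<open>l\<close> and rank \<open>m + Suc d\<close> would give \<open>r\<close>, so the
    ranks in between land strictly inside.\<close>
  let ?g = "\<lambda>k. l + (r - l) * (real (k - m) / real (Suc d))"
  let ?q = "(\<chi> b. if b \<in> B then ?g (\<rho> b) else 0) :: real^'a"
  have rng: "m < \<rho> b" "\<rho> b \<le> m + d" if "b \<in> B" for b
    using assms(1) that by (auto simp: bij_betw_def)
  have g_mono: "?g i < ?g j" if "m \<le> i" "i < j" for i j
    using that assms(2) by (intro add_strict_left_mono mult_strict_left_mono divide_strict_right_mono) auto
  have "?g m = l" "?g (m + Suc d) = r"
    using assms(2) by (simp_all add: field_simps)
  then have "l < ?g (\<rho> b)" "?g (\<rho> b) < r" if "b \<in> B" for b
    using g_mono[of m "\<rho> b"] g_mono[of "\<rho> b" "m + Suc d"] rng[OF that] by simp_all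
  moreover have "?g (\<rho> b) < ?g (\<rho> c)" if "b \<in> B" "c \<in> B" "\<rho> b < \<rho> c" for b c
    by (rule g_mono) (use rng that in \<open>auto intro: less_imp_le\<close>)
  ultimately have "?q \<in> coord_space B \<inter> ?U"
    by (auto simp: coord_space_def)
  then show "coord_space B \<inter> ?U \<noteq> {}" by blast
  show "coord_space B \<inter> ?U \<subseteq> order_simplex B \<rho> l r"
  proof
    fix f assume f: "f \<in> coord_space B \<inter> ?U"
    have "f $ b \<le> f $ c" if "b \<in> B" "c \<in> B" "\<rho> b \<le> \<rho> c" for b c
    proof (cases "\<rho> b = \<rho> c")
      case True
      then have "b = c" using that assms(1) by (auto simp: bij_betw_def inj_on_def)
      then show ?thesis by simp
    next
      case False
      then show ?thesis using f that by (auto intro: less_imp_le)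
    qed
    then show "f \<in> order_simplex B \<rho> l r"
      using f by (auto simp: order_simplex_def intro: less_imp_le)
  qed
qed

lemma aff_dim_order_simplex:
  assumes "bij_betw \<rho> B {m<..m+d}" "l < r"
  shows "aff_dim (order_simplex B \<rho> l r) = int d"
proof -
  obtain U where "open U" "coord_space B \<inter> U \<noteq> {}" "coord_space B \<inter> U \<subseteq> order_simplex B \<rho> l r"
    using order_simplex_open_subset[OF assms] .
  then have "aff_dim (order_simplex B \<rho> l r) = int (card B)"
    by (intro aff_dim_open_subset) (auto simp: order_simplex_def)
  also have "card B = d"
    using bij_betw_same_card[OF assms(1)] by simp
  finally show ?thesis .
qed

lemma convex_order_simplex: "convex (order_simplex B \<rho> l r)"
proof (rule convexI)
  fix f g :: "real^'a" and u v :: real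
  assume f: "f \<in> order_simplex B \<rho> l r" and g: "g \<in> order_simplex B \<rho> l r"
    and uv: "0 \<le> u" "0 \<le> v" "u + v = 1"
  have *: "l \<le> u * y + v * z \<and> u * y + v * z \<le> r" if "l \<le> y" "y \<le> r" "l \<le> z" "z \<le> r" for y z
  proof -
    have "u * l + v * l \<le> u * y + v * z" "u * y + v * z \<le> u * r + v * r"
      using that uv by (intro add_mono mult_left_mono; simp)+
    then show ?thesis using uv by (simp flip: distrib_right)
  qed
  show "u *\<^sub>R f + v *\<^sub>R g \<in> order_simplex B \<rho> l r"
    using f g uv(1,2) *
    by (auto simp: order_simplex_def coord_space_def intro!: add_mono mult_left_mono)
qed

text \<open>The vertices are the increasing step functions with values \<open>l\<close> and
  \<open>r\<close>; the barycentric coordinates of \<open>f\<close> are the gaps between its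
  consecutive sorted values, divided by \<open>r - l\<close>.\<close>

lemma simplex_order_simplex:
  assumes "bij_betw \<rho> B {m<..m+d}" "l < r"
  shows "int d simplex order_simplex B \<rho> l r"
proof (rule simplexI_aff_dim)
  \<comment> \<open>\<open>?v k\<close> equals \<open>l\<close> on the first \<open>k\<close> ranks
    and \<open>r\<close> on the others.\<close>
  let ?v = "\<lambda>k. (\<chi> b. if b \<in> B then (if \<rho> b \<le> m + k then l else r) else 0) :: real^'a"
  let ?C = "?v ` {..d}"
  show "finite ?C" by simp
  show "card ?C \<le> Suc d" using card_image_le[of "{..d}" ?v] by simp
  show "aff_dim (order_simplex B \<rho> l r) = int d" by (rule aff_dim_order_simplex[OF assms])
  show "order_simplex B \<rho> l r = convex hull ?C"
  proof
    show "convex hull ?C \<subseteq> order_simplex B \<rho> l r"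
      by (rule hull_minimal[where S = convex, OF _ convex_order_simplex])
         (use assms(2) in \<open>auto simp: order_simplex_def coord_space_def\<close>)
    show "order_simplex B \<rho> l r \<subseteq> convex hull ?C"
    proof
      fix f assume f: "f \<in> order_simplex B \<rho> l r"
      \<comment> \<open>The sorted values of \<open>f\<close>, padded with \<open>l\<close> in front
        and \<open>r\<close> at index \<open>d + 1\<close>, so that there are \<open>d + 1\<close>
        gaps, one for each vertex.\<close>
      define y where "y k = (if k = 0 then l else if k \<le> d then f $ inv_into B \<rho> (m + k) else r)" for k
      have inB: "inv_into B \<rho> (m + k) \<in> B" "\<rho> (inv_into B \<rho> (m + k)) = m + k" if "0 < k" "k \<le> d" for k
        using assms(1) that by (auto simp: bij_betw_def intro!: inv_into_into f_inv_into_f)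
      have y_mono: "y k \<le> y (Suc k)" for k
        using f assms(2) inB(1)[of k] inB(2)[of k] inB(1)[of "Suc k"] inB(2)[of "Suc k"]
        by (auto simp: y_def order_simplex_def)
      define w where "w k = (y (Suc k) - y k) / (r - l)" for k
      have w0: "0 \<le> w k" for k using y_mono assms(2) by (simp add: w_def)
      have tel: "(\<Sum>k<j. w k) = (y j - l) / (r - l)" for j
        by (simp add: w_def sum_divide_distrib[symmetric] sum_lessThan_telescope) (simp add: y_def)
      have w1: "sum w {..d} = 1"
        using tel[of "Suc d"] assms(2) by (simp add: lessThan_Suc_atMost y_def)
      have "(\<Sum>k\<le>d. w k *\<^sub>R ?v k) = f"
      proof (rule vec_eq_iff[THEN iffD2], rule allI)
        fix b
        show "(\<Sum>k\<le>d. w k *\<^sub>R ?v k) $ b = f $ b"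
        proof (cases "b \<in> B")
          case False
          then show ?thesis using f by (simp add: order_simplex_def coord_space_def)
        next
          case True
          define j where "j = \<rho> b - m"
          have j: "0 < j" "j \<le> d" "\<rho> b = m + j"
            using bij_betwE[OF assms(1), rule_format, OF True] by (auto simp: j_def)
          have yj: "y j = f $ b"
            using j True assms(1) by (auto simp: y_def bij_betw_def inv_into_f_f simp flip: j(3))
          \<comment> \<open>At rank \<open>m + j\<close> the vertex \<open>?v k\<close> has the
            value \<open>r\<close> exactly when \<open>k < j\<close>, so the sum is \<open>l\<close>
            plus the total of the first \<open>j\<close> gaps.\<close>
          have "(\<Sum>k\<le>d. w k *\<^sub>R ?v k) $ b = (\<Sum>k\<le>d. l * w k + (if k < j then (r - l) * w k else 0))"
            using True j by (auto simp: algebra_simps intro!: sum.cong)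
          also have "\<dots> = l * sum w {..d} + (\<Sum>k\<le>d. if k < j then (r - l) * w k else 0)"
            by (simp only: sum.distrib sum_distrib_left)
          also have "(\<Sum>k\<le>d. if k < j then (r - l) * w k else 0) = (r - l) * (\<Sum>k<j. w k)"
            unfolding sum_distrib_left using j by (intro sum.mono_neutral_cong_right) auto
          also have "l * sum w {..d} + (r - l) * (\<Sum>k<j. w k) = f $ b"
            using assms(2) by (simp add: w1 tel yj)
          finally show ?thesis .
        qed
      qed
      moreover have "(\<Sum>k\<le>d. w k *\<^sub>R ?v k) \<in> convex hull ?C"
        by (rule convex_sum) (use w0 w1 in \<open>auto intro: hull_inc\<close>)
      ultimately show "f \<in> convex hull ?C" by simp
    qed
  qed
qed

subsection \<open>Volumes of order simplices and of products\<close>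

text \<open>Counterpart of \<open>order_simplex\<close> among the extensional functions on
  \<open>B\<close>, where the product measure lives.\<close>

definition order_chain :: "'a set \<Rightarrow> ('a \<Rightarrow> nat) \<Rightarrow> real \<Rightarrow> real \<Rightarrow> ('a \<Rightarrow> real) set" where
  "order_chain B \<rho> l r =
     {f \<in> space (Pi\<^sub>M B (\<lambda>_. lborel)). (\<forall>b\<in>B. l \<le> f b \<and> f b \<le> r) \<and>
        (\<forall>b\<in>B. \<forall>c\<in>B. \<rho> b \<le> \<rho> c \<longrightarrow> f b \<le> f c)}"

lemma order_chain_sets:
  assumes "finite B"
  shows "order_chain B \<rho> l r \<in> sets (Pi\<^sub>M B (\<lambda>_. lborel))"
proof -
  let ?M = "Pi\<^sub>M B (\<lambda>_. lborel) :: ('a \<Rightarrow> real) measure"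
  have comp: "(\<lambda>f. f b) \<in> borel_measurable ?M" if "b \<in> B" for b
    using measurable_component_singleton[OF that, of "\<lambda>_. lborel"] by simp
  have "order_chain B \<rho> l r =
      {f \<in> space ?M. \<forall>b\<in>B. l \<le> f b} \<inter> {f \<in> space ?M. \<forall>b\<in>B. f b \<le> r} \<inter>
      {f \<in> space ?M. \<forall>b\<in>B. \<forall>c\<in>{c\<in>B. \<rho> b \<le> \<rho> c}. f b \<le> f c}"
    by (auto simp: order_chain_def)
  also have "\<dots> \<in> sets ?M"
    using assms
    by (intro sets.Int sets.sets_Collect_finite_All borel_measurable_le comp borel_measurable_const) auto
  finally show ?thesis .
qed

lemma emeasure_order_chain:
  assumes "finite B" "inj_on \<rho> B" "l \<le> r"
  shows "emeasure (Pi\<^sub>M B (\<lambda>_. lborel)) (order_chain B \<rho> l r) = ennreal ((r - l) ^ card B / fact (card B))"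
  using assms
proof (induction "card B" arbitrary: B r)
  case 0
  then have "B = {}" by simp
  moreover have "order_chain {} \<rho> l r = {\<lambda>_. undefined}"
    by (auto simp: order_chain_def space_PiM)
  ultimately show ?case by simp
next
  case (Suc k)
  then have "B \<noteq> {}" by auto
  obtain m where m: "m \<in> B" and max: "\<And>b. b \<in> B \<Longrightarrow> \<rho> b \<le> \<rho> m"
    using Max_in[of "\<rho> ` B"] Max_ge[of "\<rho> ` B"] Suc.prems(1) \<open>B \<noteq> {}\<close> by fastforce
  define B' where "B' = B - {m}"
  have B: "B = insert m B'" "finite B'" "m \<notin> B'" and k: "k = card B'"
    using m Suc.prems(1) Suc.hyps(2) by (auto simp: B'_def)
  have inj: "inj_on \<rho> B'" using Suc.prems(2) B by (auto simp: inj_on_insert)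
  have less: "\<rho> b < \<rho> m" if "b \<in> B'" for b
    using max[of b] that Suc.prems(2) B by (auto simp: inj_on_def order.strict_iff_order)
  interpret product_sigma_finite "\<lambda>_::'a. lborel :: real measure" ..
  \<comment> \<open>Once the top coordinate has the value \<open>y\<close>, the others form a chain
    in which \<open>y\<close> replaces \<open>r\<close> as the upper bound.\<close>
  have ind: "indicator (order_chain B \<rho> l r) (f(m := y)) =
      (indicator {l..r} y * indicator (order_chain B' \<rho> l y) f :: ennreal)"
    if f: "f \<in> space (Pi\<^sub>M B' (\<lambda>_. lborel))" for f y
  proof -
    have sp: "f(m := y) \<in> space (Pi\<^sub>M B (\<lambda>_. lborel))"
      using f by (auto simp: space_PiM B(1) PiE_def extensional_def)
    have "f(m := y) \<in> order_chain B \<rho> l r \<longleftrightarrow> y \<in> {l..r} \<and> f \<in> order_chain B' \<rho> l y"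
    proof
      assume L: "f(m := y) \<in> order_chain B \<rho> l r"
      have rng: "l \<le> (f(m := y)) b \<and> (f(m := y)) b \<le> r" if "b \<in> B" for b
        using L that unfolding order_chain_def by blast
      have mon: "(f(m := y)) b \<le> (f(m := y)) c" if "b \<in> B" "c \<in> B" "\<rho> b \<le> \<rho> c" for b c
        using L that unfolding order_chain_def by blast
      have 1: "l \<le> y \<and> y \<le> r" using rng[OF m] by simp
      have 2: "l \<le> f b \<and> f b \<le> y" if "b \<in> B'" for b
      proof -
        have "b \<noteq> m" "b \<in> B" "\<rho> b \<le> \<rho> m" using that B less[OF that] by auto
        then show ?thesis using rng[of b] mon[of b m] m by simp
      qed
      have 3: "f b \<le> f c" if "b \<in> B'" "c \<in> B'" "\<rho> b \<le> \<rho> c" for b c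
      proof -
        have "b \<noteq> m" "c \<noteq> m" "b \<in> B" "c \<in> B" using that B by auto
        then show ?thesis using mon[OF _ _ that(3)] by simp
      qed
      show "y \<in> {l..r} \<and> f \<in> order_chain B' \<rho> l y"
        using 1 2 3 f by (simp add: order_chain_def)
    next
      assume R: "y \<in> {l..r} \<and> f \<in> order_chain B' \<rho> l y"
      then have R: "l \<le> y" "y \<le> r" "\<And>b. b \<in> B' \<Longrightarrow> l \<le> f b \<and> f b \<le> y"
        "\<And>b c. b \<in> B' \<Longrightarrow> c \<in> B' \<Longrightarrow> \<rho> b \<le> \<rho> c \<Longrightarrow> f b \<le> f c"
        by (auto simp: order_chain_def)
      have "l \<le> (f(m := y)) b \<and> (f(m := y)) b \<le> r" if "b \<in> B" for b
        using R(1,2) R(3)[of b] that B(1) by (cases "b = m") auto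
      moreover have "(f(m := y)) b \<le> (f(m := y)) c" if "b \<in> B" "c \<in> B" "\<rho> b \<le> \<rho> c" for b c
      proof (cases "c = m")
        case True
        then show ?thesis using R(3)[of b] that B(1) by (cases "b = m") auto
      next
        case False
        then have "c \<in> B'" "b \<noteq> m" using that B(1) less[of c] by auto
        then show ?thesis using R(4)[of b c] that B(1) False by auto
      qed
      ultimately show "f(m := y) \<in> order_chain B \<rho> l r"
        using sp by (simp add: order_chain_def)
    qed
    then show ?thesis by (auto split: split_indicator)
  qed
  have "emeasure (Pi\<^sub>M B (\<lambda>_. lborel)) (order_chain B \<rho> l r) =
      (\<integral>\<^sup>+ f. indicator (order_chain B \<rho> l r) f \<partial>Pi\<^sub>M B (\<lambda>_. lborel))"
    using Suc.prems(1) by (simp add: order_chain_sets)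
  also have "\<dots> = (\<integral>\<^sup>+ y. (\<integral>\<^sup>+ f. indicator (order_chain B \<rho> l r) (f(m := y)) \<partial>Pi\<^sub>M B' (\<lambda>_. lborel)) \<partial>lborel)"
    unfolding B(1)
    by (rule product_nn_integral_insert_rev)
      (use B(2,3) order_chain_sets[of "insert m B'"] in \<open>auto intro!: borel_measurable_indicator\<close>)
  also have "\<dots> = (\<integral>\<^sup>+ y. (\<integral>\<^sup>+ f. indicator {l..r} y * indicator (order_chain B' \<rho> l y) f \<partial>Pi\<^sub>M B' (\<lambda>_. lborel)) \<partial>lborel)"
    by (intro nn_integral_cong ind)
  also have "\<dots> = (\<integral>\<^sup>+ y. indicator {l..r} y * emeasure (Pi\<^sub>M B' (\<lambda>_. lborel)) (order_chain B' \<rho> l y) \<partial>lborel)"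
    using order_chain_sets[OF B(2)]
    by (intro nn_integral_cong) (simp only: nn_integral_cmult borel_measurable_indicator nn_integral_indicator)
  also have "\<dots> = (\<integral>\<^sup>+ y. ennreal ((y - l) ^ k / fact k) * indicator {l..r} y \<partial>lborel)"
  proof (intro nn_integral_cong)
    fix y
    show "indicator {l..r} y * emeasure (Pi\<^sub>M B' (\<lambda>_. lborel)) (order_chain B' \<rho> l y) =
        ennreal ((y - l) ^ k / fact k) * indicator {l..r} y"
      using Suc.hyps(1)[OF k B(2) inj, of y] k by (auto split: split_indicator)
  qed
  \<comment> \<open>Fundamental theorem of calculus with the antiderivative
    \<open>(y - l) ^ Suc k / fact (Suc k)\<close>, which vanishes at \<open>y = l\<close>.\<close>
  also have "\<dots> = ennreal ((r - l) ^ Suc k / fact (Suc k) - (l - l) ^ Suc k / fact (Suc k))"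
  proof (rule nn_integral_FTC_Icc)
    fix y
    have "((\<lambda>y. (y - l) ^ Suc k) has_real_derivative real (Suc k) * (y - l) ^ k) (at y)"
      using DERIV_power_Suc[OF DERIV_diff[OF DERIV_ident DERIV_const], where n = k] by simp
    from DERIV_cdivide[OF this]
    have "((\<lambda>y. (y - l) ^ Suc k / fact (Suc k)) has_real_derivative
        (real (Suc k) * (y - l) ^ k) / fact (Suc k)) (at y)" .
    also have "(real (Suc k) * (y - l) ^ k) / fact (Suc k) = (y - l) ^ k / fact k"
      unfolding fact_Suc by (simp del: of_nat_Suc)
    finally show "((\<lambda>y. (y - l) ^ Suc k / fact (Suc k)) has_real_derivative (y - l) ^ k / fact k) (at y)" .
  qed (use Suc.prems in auto)
  also have "\<dots> = ennreal ((r - l) ^ card B / fact (card B))"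
    using Suc.hyps(2) by (simp flip: Suc.hyps(2))
  finally show ?case .
qed

section \<open>Product measure over disjoint blocks of coordinates\<close>

text \<open>Integrating over \<open>J\<close> inside \<open>I\<close> by means of
  \<open>merge\<close> turns the indicator of the set into a product of two indicators, one for each
  block.\<close>

lemma emeasure_PiM_Un:
  fixes M :: "'a \<Rightarrow> 'b measure"
  assumes M: "product_sigma_finite M" and IJ: "I \<inter> J = {}" "finite I" "finite J"
    and X: "X \<in> sets (Pi\<^sub>M I M)" and Y: "Y \<in> sets (Pi\<^sub>M J M)"
  shows "{f \<in> space (Pi\<^sub>M (I \<union> J) M). restrict f I \<in> X \<and> restrict f J \<in> Y} \<in> sets (Pi\<^sub>M (I \<union> J) M)"
      (is "?S \<in> _")
    and "emeasure (Pi\<^sub>M (I \<union> J) M) {f \<in> space (Pi\<^sub>M (I \<union> J) M). restrict f I \<in> X \<and> restrict f J \<in> Y} =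
      emeasure (Pi\<^sub>M I M) X * emeasure (Pi\<^sub>M J M) Y"
proof -
  interpret product_sigma_finite M by fact
  have "(\<lambda>f. restrict f I) -` X \<inter> space (Pi\<^sub>M (I \<union> J) M) \<in> sets (Pi\<^sub>M (I \<union> J) M)"
    "(\<lambda>f. restrict f J) -` Y \<inter> space (Pi\<^sub>M (I \<union> J) M) \<in> sets (Pi\<^sub>M (I \<union> J) M)"
    using X Y by (auto intro!: measurable_sets[OF measurable_restrict_subset])
  moreover have "?S = ((\<lambda>f. restrict f I) -` X \<inter> space (Pi\<^sub>M (I \<union> J) M)) \<inter>
      ((\<lambda>f. restrict f J) -` Y \<inter> space (Pi\<^sub>M (I \<union> J) M))"
    by blast
  ultimately show S: "?S \<in> sets (Pi\<^sub>M (I \<union> J) M)"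
    by (metis sets.Int)
  have ind: "indicator ?S (merge I J (f, g)) = (indicator X f * indicator Y g :: ennreal)"
    if f: "f \<in> space (Pi\<^sub>M I M)" and g: "g \<in> space (Pi\<^sub>M J M)" for f g
  proof -
    have "merge I J (f, g) \<in> space (Pi\<^sub>M (I \<union> J) M)"
      using f g IJ(1) by (auto simp: space_PiM PiE_iff)
    moreover have "restrict (merge I J (f, g)) I = f"
    proof
      fix b
      show "restrict (merge I J (f, g)) I b = f b"
        using f IJ(1) by (cases "b \<in> I") (auto simp: space_PiM PiE_def extensional_def)
    qed
    moreover have "restrict (merge I J (f, g)) J = g"
    proof
      fix b
      show "restrict (merge I J (f, g)) J b = g b"
        using g IJ(1) by (cases "b \<in> J") (auto simp: space_PiM PiE_def extensional_def)
    qed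
    ultimately have "merge I J (f, g) \<in> ?S \<longleftrightarrow> f \<in> X \<and> g \<in> Y"
      by simp
    then show ?thesis by (simp add: indicator_def)
  qed
  have "emeasure (Pi\<^sub>M (I \<union> J) M) ?S = (\<integral>\<^sup>+ f. indicator ?S f \<partial>Pi\<^sub>M (I \<union> J) M)"
    by (rule nn_integral_indicator[OF S, symmetric])
  also have "\<dots> = (\<integral>\<^sup>+ f. \<integral>\<^sup>+ g. indicator ?S (merge I J (f, g)) \<partial>Pi\<^sub>M J M \<partial>Pi\<^sub>M I M)"
    by (rule product_nn_integral_fold[OF IJ borel_measurable_indicator[OF S]])
  also have "\<dots> = (\<integral>\<^sup>+ f. \<integral>\<^sup>+ g. indicator X f * indicator Y g \<partial>Pi\<^sub>M J M \<partial>Pi\<^sub>M I M)"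
    by (intro nn_integral_cong ind)
  also have "\<dots> = emeasure (Pi\<^sub>M I M) X * emeasure (Pi\<^sub>M J M) Y"
    using X Y by (simp add: nn_integral_cmult nn_integral_multc)
  finally show "emeasure (Pi\<^sub>M (I \<union> J) M) ?S = emeasure (Pi\<^sub>M I M) X * emeasure (Pi\<^sub>M J M) Y" .
qed

text \<open>Induction on \<open>n\<close>, splitting off the last block. Measurability is part of
  the claim because the case of two blocks asks for it; \<open>A\<close> is a function of
  \<open>n\<close> so that the coordinate set grows along the induction.\<close>

lemma emeasure_PiM_blocks:
  fixes B :: "nat \<Rightarrow> 'a set" and M :: "'a \<Rightarrow> 'b measure"
  assumes M: "product_sigma_finite M"
    and "disjoint_family_on B {1..n}" "\<And>i. i \<in> {1..n} \<Longrightarrow> finite (B i)"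
    and "\<And>i. i \<in> {1..n} \<Longrightarrow> X i \<in> sets (Pi\<^sub>M (B i) M)"
  defines "A \<equiv> \<lambda>n. \<Union>i\<in>{1..n}. B i"
  shows "{f \<in> space (Pi\<^sub>M (A n) M). \<forall>i\<in>{1..n}. restrict f (B i) \<in> X i} \<in> sets (Pi\<^sub>M (A n) M) \<and>
    emeasure (Pi\<^sub>M (A n) M) {f \<in> space (Pi\<^sub>M (A n) M). \<forall>i\<in>{1..n}. restrict f (B i) \<in> X i} =
     (\<Prod>i=1..n. emeasure (Pi\<^sub>M (B i) M) (X i))"
  using assms(2-4)
proof (induction n)
  case 0
  then show ?case
    \<comment> \<open>Without blocks the space is a single point of mass 1, which matches the empty
      product.\<close>
    using sets.top[of "Pi\<^sub>M {} M"] by (simp add: space_PiM A_def)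
next
  case (Suc n)
  let ?S = "\<lambda>n. {f \<in> space (Pi\<^sub>M (A n) M). \<forall>i\<in>{1..n}. restrict f (B i) \<in> X i}"
  have A: "A (Suc n) = A n \<union> B (Suc n)"
    by (auto simp: A_def atLeastAtMostSuc_conv)
  have "B i \<inter> B (Suc n) = {}" if "i \<in> {1..n}" for i
    using that by (intro disjoint_family_onD[OF Suc.prems(1)]) auto
  then have disj: "A n \<inter> B (Suc n) = {}"
    unfolding A_def by blast
  have fin: "finite (A n)" "finite (B (Suc n))"
    using Suc.prems(2) by (auto simp: A_def)
  have IH: "?S n \<in> sets (Pi\<^sub>M (A n) M) \<and>
      emeasure (Pi\<^sub>M (A n) M) (?S n) = (\<Prod>i=1..n. emeasure (Pi\<^sub>M (B i) M) (X i))"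
    by (rule Suc.IH) (use Suc.prems in \<open>auto simp: disjoint_family_on_def\<close>)
  have "?S (Suc n) = {f \<in> space (Pi\<^sub>M (A n \<union> B (Suc n)) M).
      restrict f (A n) \<in> ?S n \<and> restrict f (B (Suc n)) \<in> X (Suc n)}"
  proof (rule Collect_cong)
    fix f :: "'a \<Rightarrow> 'b"
    have "restrict (restrict f (A n)) (B i) = restrict f (B i)" if "i \<in> {1..n}" for i
      using that by (auto simp: A_def restrict_restrict intro!: arg_cong[where f = "restrict f"])
    moreover have "restrict f (A n) \<in> space (Pi\<^sub>M (A n) M)" if "f \<in> space (Pi\<^sub>M (A n \<union> B (Suc n)) M)"
      using that by (auto simp: space_PiM PiE_iff)
    ultimately show "f \<in> space (Pi\<^sub>M (A (Suc n)) M) \<and> (\<forall>i\<in>{1..Suc n}. restrict f (B i) \<in> X i) \<longleftrightarrow>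
      f \<in> space (Pi\<^sub>M (A n \<union> B (Suc n)) M) \<and> restrict f (A n) \<in> ?S n \<and> restrict f (B (Suc n)) \<in> X (Suc n)"
      unfolding A by (auto simp: atLeastAtMostSuc_conv)
  qed
  then have "?S (Suc n) \<in> sets (Pi\<^sub>M (A (Suc n)) M) \<and> emeasure (Pi\<^sub>M (A (Suc n)) M) (?S (Suc n)) =
      emeasure (Pi\<^sub>M (A n) M) (?S n) * emeasure (Pi\<^sub>M (B (Suc n)) M) (X (Suc n))"
    using emeasure_PiM_Un[OF M disj fin conjunct1[OF IH], of "X (Suc n)"] Suc.prems(3)[of "Suc n"]
    by (simp only: A) simp
  also have "emeasure (Pi\<^sub>M (A n) M) (?S n) * emeasure (Pi\<^sub>M (B (Suc n)) M) (X (Suc n)) =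
      (\<Prod>i=1..Suc n. emeasure (Pi\<^sub>M (B i) M) (X i))"
    by (simp only: IH) simp
  finally show ?case .
qed

lemma coord_space_eqI:
  assumes "f \<in> coord_space A" "g \<in> coord_space A" "\<And>b. b \<in> A \<Longrightarrow> f $ b = g $ b"
  shows "f = g"
  using assms by (fastforce simp: coord_space_def vec_eq_iff)

text \<open>Passage from the coordinate subspace of \<open>real^'a\<close> to the product space in
  which \<open>coord_volume\<close> is measured, with the conditions kept separate for each
  block.\<close>

lemma image_coords_order_simplexes:
  fixes B :: "nat \<Rightarrow> 'a::finite set"
  assumes "(\<Union>i\<in>{1..n}. B i) = A"
  shows "(\<lambda>f. \<lambda>b\<in>A. f $ b) `
      {f \<in> coord_space A. \<forall>i\<in>{1..n}. coord_proj (B i) f \<in> order_simplex (B i) \<rho> (l i) (r i)} =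
    {f \<in> space (Pi\<^sub>M A (\<lambda>_. lborel)). \<forall>i\<in>{1..n}. restrict f (B i) \<in> order_chain (B i) \<rho> (l i) (r i)}"
    (is "?\<phi> ` ?S = ?T")
proof -
  have *: "coord_proj (B i) f \<in> order_simplex (B i) \<rho> (l i) (r i) \<longleftrightarrow>
      restrict (?\<phi> f) (B i) \<in> order_chain (B i) \<rho> (l i) (r i)" if "i \<in> {1..n}" for i f
  proof -
    have "B i \<subseteq> A" using that assms by blast
    then have "restrict (?\<phi> f) (B i) = (\<lambda>b\<in>B i. f $ b)"
      by (auto simp: fun_eq_iff)
    then show ?thesis
      by (auto simp: order_simplex_def order_chain_def coord_proj_def coord_space_def space_PiM)
  qed
  show ?thesis
  proof
    show "?\<phi> ` ?S \<subseteq> ?T" using * by (auto simp: space_PiM)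
    show "?T \<subseteq> ?\<phi> ` ?S"
    proof
      fix g assume g: "g \<in> ?T"
      \<comment> \<open>Extension by zero inverts the restriction to \<open>A\<close>.\<close>
      let ?f = "(\<chi> b. if b \<in> A then g b else 0) :: real^'a"
      have \<phi>: "?\<phi> ?f = g" using g by (auto simp: space_PiM PiE_def extensional_def fun_eq_iff)
      have "?f \<in> ?S"
      proof (intro CollectI conjI ballI)
        show "?f \<in> coord_space A" by (simp add: coord_space_def)
        show "coord_proj (B i) ?f \<in> order_simplex (B i) \<rho> (l i) (r i)" if "i \<in> {1..n}" for i
          unfolding *[OF that] \<phi> using g that by blast
      qed
      with \<phi> show "g \<in> ?\<phi> ` ?S" by (metis (no_types, lifting) imageI)
    qed
  qed
qed

section \<open>Ranks in a finite total order\<close>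

lemma exists_sorting_bijection:
  fixes le :: "'a::finite \<Rightarrow> 'a \<Rightarrow> bool"
  assumes total: "\<And>a b. le a b \<or> le b a"
    and trans: "\<And>a b c. le a b \<Longrightarrow> le b c \<Longrightarrow> le a c"
    and antisym: "\<And>a b. le a b \<Longrightarrow> le b a \<Longrightarrow> a = b"
  obtains \<pi> where "bij_betw \<pi> UNIV {1..CARD('a)}" "\<And>a b. \<pi> a \<le> \<pi> b \<longleftrightarrow> le a b"
proof
  \<comment> \<open>The rank of \<open>a\<close> counts the elements up to and including
    \<open>a\<close>, so ranks start at 1.\<close>
  let ?\<pi> = "\<lambda>a. card {b. le b a}"
  show le: "?\<pi> a \<le> ?\<pi> b \<longleftrightarrow> le a b" for a b
  proof
    assume "le a b"
    then show "?\<pi> a \<le> ?\<pi> b" using trans by (intro card_mono) auto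
  next
    assume card_le: "?\<pi> a \<le> ?\<pi> b"
    show "le a b"
    proof (rule ccontr)
      assume "\<not> le a b"
      then have "{c. le c b} \<subset> {c. le c a}" using total trans by blast
      then have "?\<pi> b < ?\<pi> a" by (intro psubset_card_mono) auto
      with card_le show False by simp
    qed
  qed
  have inj: "inj ?\<pi>"
    using le by (intro injI) (metis antisym order_refl)
  have "?\<pi> a \<in> {1..CARD('a)}" for a
  proof -
    have "a \<in> {b. le b a}" using total[of a a] by simp
    then have "0 < ?\<pi> a" by (auto simp: card_gt_0_iff)
    moreover have "?\<pi> a \<le> CARD('a)" by (intro card_mono) auto
    ultimately show ?thesis by simp
  qed
  then have "?\<pi> ` UNIV \<subseteq> {1..CARD('a)}" by blast
  then have "?\<pi> ` UNIV = {1..CARD('a)}"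
    by (rule card_subset_eq[rotated]) (simp_all add: card_image inj)
  with inj show "bij_betw ?\<pi> UNIV {1..CARD('a)}" by (simp add: bij_betw_def)
qed

subsection \<open>Heights and values on the chain\<close>

locale chain_in_poset =
  fixes p n :: nat and \<alpha> t :: "nat \<Rightarrow> 'a::{finite,order}" and x u :: "nat \<Rightarrow> real"
  assumes labeling: "natural_labeling p \<alpha>"
    and n_pos: "1 \<le> n"
    and t_mono: "strict_mono_on {1..n} t"
    and top_unique: "\<forall>m. (\<forall>y. \<not> m < y) \<longleftrightarrow> m = t n"
    and x_pos: "\<forall>i\<in>{1..n}. 0 < x i"
    and u_eq: "\<forall>i\<in>{1..n}. u i = (\<Sum>j=1..i. x j)"
begin

abbreviation "A \<equiv> - t ` {1..n}"
abbreviation "L \<equiv> (linear_extensions p :: ('a \<Rightarrow> nat) set)"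
abbreviation "ext \<equiv> extend_by t n u"
abbreviation "cell \<equiv> Lambda_cell p \<alpha> t n u"
abbreviation "sect \<equiv> order_cone_section t n u"

text \<open>In a finite poset every element lies below a maximal one, and \<open>t n\<close> is the
  only maximal one.\<close>

lemma le_top: "b \<le> t n"
proof -
  obtain m where "b \<le> m" "\<And>y. m \<le> y \<Longrightarrow> m = y"
    using finite_has_maximal2[of "UNIV :: 'a set" b] by auto
  then have "m = t n" using top_unique by (metis order.strict_iff_order)
  with \<open>b \<le> m\<close> show ?thesis by simp
qed

lemma p_eq: "p = CARD('a)"
  using bij_betw_same_card[of \<alpha> "{1..p}" UNIV] labeling by (auto simp: natural_labeling_def)

lemma inj_t: "inj_on t {1..n}"
  using t_mono by (rule strict_mono_on_imp_inj_on)

lemma ext_t: "i \<in> {1..n} \<Longrightarrow> ext f (t i) = u i"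
  using inv_into_f_f[OF inj_t, of i] by (simp add: extend_by_def)

lemma ext_A: "b \<in> A \<Longrightarrow> ext f b = f $ b"
  by (simp add: extend_by_def)

text \<open>The value on the chain at step \<open>i\<close>, with \<open>v 0 = 0\<close>, unlike \<open>u 0\<close>, which is unspecified.\<close>

definition v :: "nat \<Rightarrow> real" where "v i = (\<Sum>j=1..i. x j)"

lemma v_0: "v 0 = 0" by (simp add: v_def)

lemma v_u: "i \<in> {1..n} \<Longrightarrow> v i = u i" using u_eq by (simp add: v_def)

lemma v_diff: "1 \<le> i \<Longrightarrow> v i - v (i - 1) = x i"
  by (cases i) (simp_all add: v_def)

lemma v_mono: "i \<le> j \<Longrightarrow> j \<le> n \<Longrightarrow> v i \<le> v j"
  unfolding v_def using x_pos by (intro sum_mono2) (auto intro: less_imp_le)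

lemma v_step: "i \<in> {1..n} \<Longrightarrow> v (i - 1) < v i"
  using v_diff[of i] x_pos[rule_format, of i] by auto

lemma v_nonneg: "i \<le> n \<Longrightarrow> 0 \<le> v i"
  using v_mono[of 0 i] by (simp add: v_0)

lemma linear_extension_bij: "\<pi> \<in> L \<Longrightarrow> bij_betw \<pi> UNIV {1..p}"
  by (simp add: linear_extensions_def)

text \<open>Bijectivity of \<open>\<pi> \<circ> \<alpha>\<close> gives the existence and uniqueness
  that the description operator in \<open>letter\<close> relies on.\<close>

lemma letter_position:
  assumes "\<pi> \<in> L" "i \<in> {1..p}"
  shows "\<pi> (\<alpha> (letter p \<alpha> \<pi> i)) = i"
proof -
  have bij: "bij_betw (\<pi> \<circ> \<alpha>) {1..p} {1..p}"
    using labeling linear_extension_bij[OF assms(1)] bij_betw_trans[of \<alpha> "{1..p}" UNIV \<pi> "{1..p}"]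
    by (simp add: natural_labeling_def)
  have "i \<in> (\<pi> \<circ> \<alpha>) ` {1..p}"
    using bij assms(2) by (simp only: bij_betw_imp_surj_on)
  then obtain j where j: "j \<in> {1..p}" "\<pi> (\<alpha> j) = i" by auto
  have "k = j" if "k \<in> {1..p} \<and> \<pi> (\<alpha> k) = i" for k
    using inj_onD[OF bij_betw_imp_inj_on[OF bij], of k j] that j by simp
  with j have "letter p \<alpha> \<pi> i = j"
    unfolding letter_def by (intro the_equality) auto
  then show ?thesis using j(2) by simp
qed

section \<open>Cells described by comparing all pairs of elements\<close>

text \<open>Chaining the inequalities between neighbouring letters compares all pairs, and
  nonnegativity spreads from the first letter. Later arguments work with this form and leave the
  letters behind.\<close>

lemma cell_iff:
  assumes "\<pi> \<in> L"
  shows "f \<in> cell \<pi> \<longleftrightarrow> f \<in> coord_space A \<and> (\<forall>a. 0 \<le> ext f a) \<and>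
    (\<forall>a b. \<pi> a \<le> \<pi> b \<longrightarrow> ext f a \<le> ext f b)" (is "_ = ?R")
proof
  let ?w = "\<lambda>i. \<alpha> (letter p \<alpha> \<pi> i)"
  have rng: "\<pi> a \<in> {1..p}" for a
    using linear_extension_bij[OF assms] by (auto simp: bij_betw_def)
  have w: "?w (\<pi> a) = a" for a
    using injD[OF bij_betw_imp_inj_on[OF linear_extension_bij[OF assms]] letter_position[OF assms rng]] .
  have mono: "a \<le> b \<Longrightarrow> \<pi> a \<le> \<pi> b" for a b
    using assms by (auto simp: linear_extensions_def monoD)
  {
    assume f: "f \<in> cell \<pi>"
    have le': "ext f (?w i) \<le> ext f (?w j)" if "i \<le> j" "1 \<le> i" "j \<le> p" for i j
      using that(1,3)
    proof (induction j rule: dec_induct)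
      case (step k)
      then have "ext f (?w k) \<le> ext f (?w (Suc k))"
        using f that(2) by (simp add: Lambda_cell_def)
      with step show ?case by simp
    qed simp
    have le: "ext f a \<le> ext f b" if "\<pi> a \<le> \<pi> b" for a b
      using le'[OF that] rng[of a] rng[of b] by (simp add: w)
    have nonneg: "0 \<le> ext f a" for a
    proof -
      have "0 \<le> ext f (?w 1)" using f by (simp add: Lambda_cell_def)
      also have "\<dots> \<le> ext f a"
        using rng[of a] by (intro le) (simp add: letter_position[OF assms])
      finally show ?thesis .
    qed
    show ?R using f le nonneg by (auto simp: Lambda_cell_def order_cone_section_def)
  }
  assume R: ?R
  have "0 \<le> f $ b" if "b \<in> A" for b
    using R ext_A[OF that, of f] by metis
  moreover have "f $ a \<le> f $ b" if "a \<in> A" "b \<in> A" "a \<le> b" for a b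
    using R ext_A[OF that(1), of f] ext_A[OF that(2), of f] mono[OF that(3)] by metis
  \<comment> \<open>Since \<open>\<pi>\<close> preserves the order of the poset, monotonicity along
    the word implies monotonicity on the poset.\<close>
  ultimately have "f \<in> sect"
    using R mono by (auto simp: order_cone_section_def mono_on_def mono_def)
  then show "f \<in> cell \<pi>"
    using R by (auto simp: Lambda_cell_def letter_position[OF assms])
qed

subsection \<open>The cells as products of simplices\<close>

abbreviation "h \<equiv> height t"

text \<open>Strict inequalities on both sides leave out the chain elements, which sit at the heights
  themselves; height 0 at index 0 lets the first block begin with the first letter.\<close>

definition block :: "('a \<Rightarrow> nat) \<Rightarrow> nat \<Rightarrow> 'a set" where
  "block \<pi> i = {b. h \<pi> (i - 1) < \<pi> b \<and> \<pi> b < h \<pi> i}"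

context
  fixes \<pi> assumes \<pi>: "\<pi> \<in> L"
begin

lemma pi_inj: "\<pi> a = \<pi> b \<longleftrightarrow> a = b"
  using linear_extension_bij[OF \<pi>] by (auto simp: bij_betw_def dest: injD)

lemma pi_range: "1 \<le> \<pi> a" "\<pi> a \<le> p"
  using linear_extension_bij[OF \<pi>] by (auto simp: bij_betw_def)

lemma height_t: "i \<in> {1..n} \<Longrightarrow> h \<pi> i = \<pi> (t i)"
  by (simp add: height_def)

text \<open>Strictness ensures that the truncated subtractions in the dimensions
  \<open>h \<pi> i - h \<pi> (i - 1) - 1\<close> are true differences.\<close>

lemma height_strict: "i < j \<Longrightarrow> j \<le> n \<Longrightarrow> h \<pi> i < h \<pi> j"
proof (cases "i = 0")
  case False
  assume ij: "i < j" "j \<le> n"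
  then have "t i < t j" using False t_mono by (auto simp: strict_mono_on_def)
  then have "\<pi> (t i) \<le> \<pi> (t j)" "\<pi> (t i) \<noteq> \<pi> (t j)"
    using \<pi> by (auto simp: linear_extensions_def pi_inj monoD less_imp_le)
  then show ?thesis using False ij by (simp add: height_def)
qed (use pi_range in \<open>auto simp: height_def Suc_le_eq\<close>)

lemma height_mono: "i \<le> j \<Longrightarrow> j \<le> n \<Longrightarrow> h \<pi> i \<le> h \<pi> j"
  using height_strict[of i j] by (cases "i = j") auto

lemma height_le: "i \<le> n \<Longrightarrow> h \<pi> i \<le> p"
  using pi_range by (simp add: height_def)

text \<open>Take the least \<open>i\<close> whose height reaches the position of \<open>a\<close>.
  It exists because \<open>t n\<close> lies above \<open>a\<close>, and it is positive because
  positions start at 1.\<close>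

lemma exists_step: obtains i where "i \<in> {1..n}" "h \<pi> (i - 1) < \<pi> a" "\<pi> a \<le> h \<pi> i"
proof -
  let ?P = "\<lambda>i. \<pi> a \<le> h \<pi> i"
  have "\<pi> a \<le> \<pi> (t n)" using le_top \<pi> by (auto simp: linear_extensions_def monoD)
  then have Pn: "?P n" using n_pos by (simp add: height_t)
  define i where "i = (LEAST i. ?P i)"
  have "?P i" "i \<le> n" using LeastI[of ?P, OF Pn] Least_le[of ?P, OF Pn] by (auto simp: i_def)
  moreover have "\<not> ?P 0" using pi_range[of a] by (simp add: height_def)
  then have "i \<noteq> 0" using \<open>?P i\<close> by metis
  moreover have "\<not> ?P (i - 1)" using not_less_Least[of "i - 1" ?P] \<open>i \<noteq> 0\<close> by (simp add: i_def)
  ultimately show ?thesis by (intro that[of i]) auto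
qed

lemma step_eq_top:
  assumes "i \<in> {1..n}" "\<pi> a = h \<pi> i" shows "a = t i"
  using assms by (simp add: height_t pi_inj)

lemma block_subset: "i \<in> {1..n} \<Longrightarrow> block \<pi> i \<subseteq> A"
proof
  fix b assume i: "i \<in> {1..n}" and b: "b \<in> block \<pi> i"
  show "b \<in> A"
  proof
    assume "b \<in> t ` {1..n}"
    then obtain j where j: "j \<in> {1..n}" "b = t j" by blast
    then have "h \<pi> (i - 1) < h \<pi> j" "h \<pi> j < h \<pi> i"
      using b by (auto simp: block_def height_t)
    moreover have "j \<le> i - 1 \<or> i \<le> j" by linarith
    moreover have "i - 1 \<le> n" using i by auto
    ultimately show False
      using height_mono[of j "i - 1"] height_mono[of i j] i j by auto
  qed
qed

lemma Union_block: "(\<Union>i\<in>{1..n}. block \<pi> i) = A"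
proof
  show "A \<subseteq> (\<Union>i\<in>{1..n}. block \<pi> i)"
  proof
    fix b assume b: "b \<in> A"
    obtain i where i: "i \<in> {1..n}" "h \<pi> (i - 1) < \<pi> b" "\<pi> b \<le> h \<pi> i" by (rule exists_step)
    moreover have "\<pi> b \<noteq> h \<pi> i" using step_eq_top[OF i(1)] b i(1) by blast
    ultimately show "b \<in> (\<Union>i\<in>{1..n}. block \<pi> i)" by (auto simp: block_def)
  qed
qed (use block_subset in blast)

lemma disjoint_block: "disjoint_family_on (block \<pi>) {1..n}"
proof -
  have "block \<pi> i \<inter> block \<pi> j = {}" if "i < j" "j \<le> n" for i j
    using height_mono[of i "j - 1"] that by (fastforce simp: block_def)
  then show ?thesis
    unfolding disjoint_family_on_def by (metis atLeastAtMost_iff inf_commute linorder_neqE_nat)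
qed

text \<open>The interval is written as \<open>{m<..m+d}\<close>, the form in which the order simplex
  lemmas take their ranks. Chain elements in neighbouring positions give \<open>d = 0\<close> and an
  empty block.\<close>

lemma bij_block:
  assumes "i \<in> {1..n}"
  shows "bij_betw \<pi> (block \<pi> i) {h \<pi> (i - 1)<..h \<pi> (i - 1) + (h \<pi> i - h \<pi> (i - 1) - 1)}"
proof -
  have "\<pi> ` block \<pi> i = {h \<pi> (i - 1)<..<h \<pi> i}"
  proof
    show "{h \<pi> (i - 1)<..<h \<pi> i} \<subseteq> \<pi> ` block \<pi> i"
    proof
      fix k assume k: "k \<in> {h \<pi> (i - 1)<..<h \<pi> i}"
      then have "k \<in> {1..p}" using height_le[of i] assms by auto
      then have "k \<in> range \<pi>"
        using bij_betw_imp_surj_on[OF linear_extension_bij[OF \<pi>]] by simp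
      then obtain b where "\<pi> b = k" by auto
      with k show "k \<in> \<pi> ` block \<pi> i" by (auto simp: block_def)
    qed
  qed (auto simp: block_def)
  moreover have "{h \<pi> (i - 1)<..<h \<pi> i} = {h \<pi> (i - 1)<..h \<pi> (i - 1) + (h \<pi> i - h \<pi> (i - 1) - 1)}"
    by auto
  ultimately show ?thesis by (auto simp: bij_betw_def inj_on_def pi_inj)
qed

abbreviation "simp_factor i \<equiv> order_simplex (block \<pi> i) \<pi> (v (i - 1)) (v i)"

text \<open>Elements of block \<open>i\<close> stand in the word between \<open>t (i - 1)\<close>
  and \<open>t i\<close>, so their values lie between \<open>v (i - 1)\<close> and
  \<open>v i\<close>. Conversely these bounds already order the values of different blocks, so only
  comparisons inside a block remain.\<close>

lemma cell_eq:
  "cell \<pi> = {f \<in> coord_space A. \<forall>i\<in>{1..n}. coord_proj (block \<pi> i) f \<in> simp_factor i}"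
  (is "_ = ?S")
proof (intro equalityI subsetI)
  fix f assume "f \<in> cell \<pi>"
  then have f: "f \<in> coord_space A" "\<And>a. 0 \<le> ext f a" "\<And>a b. \<pi> a \<le> \<pi> b \<Longrightarrow> ext f a \<le> ext f b"
    by (auto simp: cell_iff[OF \<pi>])
  have "coord_proj (block \<pi> i) f \<in> simp_factor i" if i: "i \<in> {1..n}" for i
  proof -
    have "v (i - 1) \<le> f $ b \<and> f $ b \<le> v i" if b: "b \<in> block \<pi> i" for b
    proof -
      have A: "b \<in> A" using b block_subset[OF i] by blast
      have "f $ b \<le> v i"
        using f(3)[of b "t i"] b i by (auto simp: ext_A[OF A] ext_t v_u block_def height_t)
      moreover have "v (i - 1) \<le> f $ b"
      \<comment> \<open>No chain element precedes the first block; there the lower bound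
        \<open>v 0 = 0\<close> is nonnegativity.\<close>
      proof (cases "i = 1")
        case True
        then show ?thesis using f(2)[of b] by (simp add: v_0 ext_A[OF A])
      next
        case False
        then have i': "i - 1 \<in> {1..n}" using i by auto
        have "\<pi> (t (i - 1)) \<le> \<pi> b"
          using b unfolding block_def height_t[OF i'] by simp
        from f(3)[OF this] show ?thesis
          by (simp only: ext_A[OF A] ext_t[OF i'] v_u[OF i'])
      qed
      ultimately show ?thesis by simp
    qed
    moreover have "f $ b \<le> f $ c" if "b \<in> block \<pi> i" "c \<in> block \<pi> i" "\<pi> b \<le> \<pi> c" for b c
      using f(3)[OF that(3)] ext_A[of b] ext_A[of c] block_subset[OF i] that(1,2) by (metis subsetD)
    ultimately show ?thesis
      by (auto simp: order_simplex_def coord_proj_in_coord_space coord_proj_def coord_space_def)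
  qed
  with f show "f \<in> ?S" by blast
next
  fix f assume f: "f \<in> ?S"
  have in_block: "v (i - 1) \<le> f $ b" "f $ b \<le> v i" if "i \<in> {1..n}" "b \<in> block \<pi> i" for i b
    using f that by (auto simp: order_simplex_def coord_proj_def)
  have mono_block: "f $ b \<le> f $ c" if "i \<in> {1..n}" "b \<in> block \<pi> i" "c \<in> block \<pi> i" "\<pi> b \<le> \<pi> c" for i b c
    using f that by (auto simp: order_simplex_def coord_proj_def)
  \<comment> \<open>The bounds of block \<open>i\<close> also hold at \<open>t i\<close>, the chain
    element that closes it.\<close>
  have step: "v (i - 1) \<le> ext f a \<and> ext f a \<le> v i"
    if "i \<in> {1..n}" "h \<pi> (i - 1) < \<pi> a" "\<pi> a \<le> h \<pi> i" for i a
  proof (cases "\<pi> a = h \<pi> i")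
    case True
    then have "ext f a = v i" using step_eq_top[of i a] that(1) by (simp add: ext_t v_u)
    then show ?thesis using v_step[OF that(1)] by simp
  next
    case False
    then have "a \<in> block \<pi> i" using that by (simp add: block_def)
    then show ?thesis
      using in_block[OF that(1)] block_subset[OF that(1)] ext_A[of a f] by (metis subsetD)
  qed
  have "0 \<le> ext f a" for a
  proof -
    obtain i where i: "i \<in> {1..n}" "h \<pi> (i - 1) < \<pi> a" "\<pi> a \<le> h \<pi> i" by (rule exists_step)
    have "i - 1 \<le> n" using i(1) by auto
    then show ?thesis using step[OF i] v_nonneg[of "i - 1"] by linarith
  qed
  moreover have "ext f a \<le> ext f b" if le: "\<pi> a \<le> \<pi> b" for a b
  proof -
    obtain i where i: "i \<in> {1..n}" "h \<pi> (i - 1) < \<pi> a" "\<pi> a \<le> h \<pi> i" by (rule exists_step)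
    obtain j where j: "j \<in> {1..n}" "h \<pi> (j - 1) < \<pi> b" "\<pi> b \<le> h \<pi> j" by (rule exists_step)
    consider "j < i" | "i < j" | "i = j" by linarith
    then show ?thesis
    proof cases
      case 1
      \<comment> \<open>This case is contradictory: \<open>b\<close> would come before
        \<open>a\<close> in the word.\<close>
      then have "h \<pi> j \<le> h \<pi> (i - 1)" using i(1) by (intro height_mono) auto
      then show ?thesis using le i j by linarith
    next
      case 2
      \<comment> \<open>The upper bound of the earlier block is at most the lower bound of the later
        one.\<close>
      then have "v i \<le> v (j - 1)" using j(1) by (intro v_mono) auto
      then show ?thesis using step[OF i] step[OF j] by linarith
    next
      case 3
      show ?thesis
      proof (cases "\<pi> b = h \<pi> j")
        case True
        then have "ext f b = v j" using step_eq_top[of j b] j(1) by (simp add: ext_t v_u)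
        then show ?thesis using step[OF i] 3 by simp
      next
        case False
        then have "a \<in> block \<pi> i" "b \<in> block \<pi> i" using i j le 3 by (auto simp: block_def)
        then show ?thesis
          using mono_block[OF i(1) _ _ le] block_subset[OF i(1)] ext_A[of a f] ext_A[of b f] by (metis subsetD)
      qed
    qed
  qed
  ultimately show "f \<in> cell \<pi>" using f by (auto simp: cell_iff[OF \<pi>])
qed

lemma product_of_simplices_cell:
  "product_of_simplices A n (\<lambda>i. h \<pi> i - h \<pi> (i - 1) - 1) (cell \<pi>)"
  unfolding product_of_simplices_def
proof (intro exI conjI ballI)
  show "disjoint_family_on (block \<pi>) {1..n}" by (rule disjoint_block)
  show "(\<Union>i\<in>{1..n}. block \<pi> i) = A" by (rule Union_block)
  fix i assume i: "i \<in> {1..n}"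
  show "simp_factor i \<subseteq> coord_space (block \<pi> i)" by (auto simp: order_simplex_def)
  show "int (h \<pi> i - h \<pi> (i - 1) - 1) simplex simp_factor i"
    by (rule simplex_order_simplex[OF bij_block[OF i] v_step[OF i]])
qed (rule cell_eq)

text \<open>The volume is the product over the blocks, and block \<open>i\<close> contributes an
  order simplex on an interval of length \<open>v i - v (i - 1) = x i\<close>.\<close>

lemma coord_volume_cell:
  "coord_volume A (cell \<pi>) =
    (\<Prod>i=1..n. x i ^ (h \<pi> i - h \<pi> (i - 1) - 1) / fact (h \<pi> i - h \<pi> (i - 1) - 1))"
proof -
  interpret product_sigma_finite "\<lambda>_::'a. lborel :: real measure" ..
  let ?X = "\<lambda>i. order_chain (block \<pi> i) \<pi> (v (i - 1)) (v i)"
  let ?d = "\<lambda>i. h \<pi> i - h \<pi> (i - 1) - 1"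
  have fac: "emeasure (Pi\<^sub>M (block \<pi> i) (\<lambda>_. lborel)) (?X i) = ennreal (x i ^ ?d i / fact (?d i))"
    if i: "i \<in> {1..n}" for i
  proof -
    have "inj_on \<pi> (block \<pi> i)" "card (block \<pi> i) = ?d i"
      using bij_betw_imp_inj_on[OF bij_block[OF i]] bij_betw_same_card[OF bij_block[OF i]] by auto
    then show ?thesis
      using emeasure_order_chain[of "block \<pi> i" \<pi> "v (i - 1)" "v i"] v_step[OF i] v_diff[of i] i by simp
  qed
  have nonneg: "0 \<le> x i ^ ?d i / fact (?d i)" if "i \<in> {1..n}" for i
    using x_pos that by (intro divide_nonneg_nonneg zero_le_power) (auto intro: less_imp_le)
  have "emeasure (Pi\<^sub>M A (\<lambda>_. lborel)) ((\<lambda>f. \<lambda>b\<in>A. f $ b) ` cell \<pi>) =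
      (\<Prod>i=1..n. emeasure (Pi\<^sub>M (block \<pi> i) (\<lambda>_. lborel)) (?X i))"
    unfolding cell_eq image_coords_order_simplexes[OF Union_block]
    using conjunct2[OF emeasure_PiM_blocks[OF product_sigma_finite_axioms disjoint_block, of ?X]]
    unfolding Union_block by (simp add: order_chain_sets)
  also have "\<dots> = (\<Prod>i=1..n. ennreal (x i ^ ?d i / fact (?d i)))"
    by (intro prod.cong fac refl)
  also have "\<dots> = ennreal (\<Prod>i=1..n. x i ^ ?d i / fact (?d i))"
    by (rule prod_ennreal) (rule nonneg)
  \<comment> \<open>Nonnegativity of the product allows the return from \<open>ennreal\<close> to
    the reals.\<close>
  finally show ?thesis
    unfolding coord_volume_def measure_def by (simp only: enn2real_ennreal prod_nonneg nonneg)
qed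

section \<open>Full dimension of the cells\<close>

text \<open>Open pieces of the factors pull back along the continuous block projections to an open
  piece of the cell; a point in it is glued from one point per block.\<close>

lemma aff_dim_cell: "aff_dim (cell \<pi>) = int (card A)"
proof -
  have "\<exists>U. open U \<and> coord_space (block \<pi> i) \<inter> U \<noteq> {} \<and> coord_space (block \<pi> i) \<inter> U \<subseteq> simp_factor i"
    if "i \<in> {1..n}" for i
    using order_simplex_open_subset[OF bij_block[OF that] v_step[OF that]] by metis
  then obtain U where U: "\<And>i. i \<in> {1..n} \<Longrightarrow> open (U i)"
      "\<And>i. i \<in> {1..n} \<Longrightarrow> coord_space (block \<pi> i) \<inter> U i \<noteq> {}"
      "\<And>i. i \<in> {1..n} \<Longrightarrow> coord_space (block \<pi> i) \<inter> U i \<subseteq> simp_factor i"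
    by metis
  have "\<exists>q. \<forall>i\<in>{1..n}. q i \<in> coord_space (block \<pi> i) \<inter> U i"
    using U(2) by (intro bchoice) blast
  then obtain q where q: "\<And>i. i \<in> {1..n} \<Longrightarrow> q i \<in> coord_space (block \<pi> i) \<inter> U i"
    by blast
  let ?V = "\<Inter>i\<in>{1..n}. coord_proj (block \<pi> i) -` U i"
  show ?thesis
  proof (rule aff_dim_open_subset)
    show "cell \<pi> \<subseteq> coord_space A" by (auto simp: cell_eq)
    show "open ?V"
      using U(1) by (auto intro!: open_INT open_vimage continuous_on_coord_proj)
    show "coord_space A \<inter> ?V \<subseteq> cell \<pi>"
    proof
      fix f assume f: "f \<in> coord_space A \<inter> ?V"
      have "coord_proj (block \<pi> i) f \<in> simp_factor i" if "i \<in> {1..n}" for i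
        using U(3)[OF that] f that coord_proj_in_coord_space[of "block \<pi> i" f] by blast
      with f show "f \<in> cell \<pi>" by (simp add: cell_eq)
    qed
    \<comment> \<open>Blocks are disjoint, so the other summands vanish on block
      \<open>i\<close>.\<close>
    have "coord_proj (block \<pi> i) (\<Sum>j=1..n. q j) = q i" if i: "i \<in> {1..n}" for i
    proof (rule coord_space_eqI)
      show "coord_proj (block \<pi> i) (\<Sum>j=1..n. q j) \<in> coord_space (block \<pi> i)"
        by (rule coord_proj_in_coord_space)
      show "q i \<in> coord_space (block \<pi> i)" using q[OF i] by simp
      fix b assume b: "b \<in> block \<pi> i"
      have "q j $ b = 0" if "j \<in> {1..n} - {i}" for j
        using q[of j] b disjoint_family_onD[OF disjoint_block, of i j] i that
        by (auto simp: coord_space_def)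
      then have "(\<Sum>j=1..n. q j $ b) = q i $ b"
        using i by (subst sum.remove[of _ i]) auto
      then show "coord_proj (block \<pi> i) (\<Sum>j=1..n. q j) $ b = q i $ b"
        using b by (simp add: coord_proj_def)
    qed
    moreover have "(\<Sum>j=1..n. q j) \<in> coord_space A"
    proof (rule subspace_sum[OF subspace_coord_space])
      fix j assume "j \<in> {1..n}"
      with q[of j] block_subset[of j] show "q j \<in> coord_space A" by (auto simp: coord_space_def)
    qed
    ultimately have "(\<Sum>j=1..n. q j) \<in> coord_space A \<inter> ?V" using q by auto
    then show "coord_space A \<inter> ?V \<noteq> {}" by blast
  qed
qed

end

subsection \<open>The subdivision\<close>

text \<open>A value of the extension is a coordinate off the chain and a constant on it. The affine
  form covers both, so each comparison of two values is a halfspace condition, possibly with zero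
  normal vector.\<close>

lemma ext_affine: "\<exists>c k. \<forall>f. ext f a = c \<bullet> f + k"
proof (cases "a \<in> A")
  case True
  then show ?thesis by (intro exI[of _ "axis a 1"] exI[of _ 0]) (simp add: extend_by_def inner_axis')
next
  case False
  then show ?thesis by (intro exI[of _ 0] exI[of _ "u (inv_into {1..n} t a)"]) (simp add: extend_by_def)
qed

lemma polyhedron_ext_le: "polyhedron {f. ext f a \<le> ext f b}"
proof -
  obtain c k where a: "\<And>f. ext f a = c \<bullet> f + k" using ext_affine[of a] by blast
  obtain d l where b: "\<And>f. ext f b = d \<bullet> f + l" using ext_affine[of b] by blast
  have "{f. ext f a \<le> ext f b} = {f. (c - d) \<bullet> f \<le> l - k}"
    by (auto simp: a b inner_diff_left)
  then show ?thesis by (simp add: polyhedron_halfspace_le)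
qed

lemma polyhedron_ext_nonneg: "polyhedron {f. 0 \<le> ext f a}"
proof -
  obtain c k where a: "\<And>f. ext f a = c \<bullet> f + k" using ext_affine[of a] by blast
  have "{f. 0 \<le> ext f a} = {f. c \<bullet> f \<ge> - k}"
    by (auto simp: a)
  then show ?thesis by (simp add: polyhedron_halfspace_ge)
qed

text \<open>The relation \<open>R\<close> is left general to serve both the section (poset order)
  and the cells (order of positions). Boundedness comes from the assumption on \<open>t n\<close>:
  all values lie between 0 and \<open>u n\<close>.\<close>

lemma polytope_order_maps:
  assumes "\<And>a. (a, t n) \<in> R"
  shows "polytope {f \<in> coord_space A. (\<forall>a. 0 \<le> ext f a) \<and> (\<forall>(a, b)\<in>R. ext f a \<le> ext f b)}"
    (is "polytope ?S")
proof -
  have "?S = coord_space A \<inter> (\<Inter>a\<in>UNIV. {f. 0 \<le> ext f a}) \<inter> (\<Inter>(a, b)\<in>R. {f. ext f a \<le> ext f b})"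
    by auto
  moreover have "polyhedron \<dots>"
    using affine_imp_polyhedron[OF subspace_imp_affine[OF subspace_coord_space[of A]]]
    by (intro polyhedron_Int polyhedron_Inter) (auto simp: polyhedron_ext_le polyhedron_ext_nonneg)
  moreover have "bounded ?S"
  proof (rule bounded_subset[OF bounded_cbox])
    have bounds: "0 \<le> f $ b \<and> f $ b \<le> u n" if f: "f \<in> ?S" for f b
    proof (cases "b \<in> A")
      case True
      have "0 \<le> ext f b" using f by blast
      moreover have "ext f b \<le> ext f (t n)" using f assms[of b] by blast
      ultimately show ?thesis using ext_t[of n f] n_pos by (simp add: ext_A[OF True])
    next
      case False
      then have "f $ b = 0" using f by (simp add: coord_space_def)
      moreover have "0 \<le> ext f (t n)" using f by blast
      ultimately show ?thesis using n_pos ext_t[of n f] by simp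
    qed
    show "?S \<subseteq> cbox 0 (\<chi> b. u n)"
    proof
      fix f assume "f \<in> ?S"
      from bounds[OF this] show "f \<in> cbox 0 (\<chi> b. u n)" by (simp add: mem_box_cart)
    qed
  qed
  ultimately show ?thesis by (simp add: polytope_eq_bounded_polyhedron)
qed

text \<open>Restates the conditions on the complement of the chain for the extension to the whole
  poset; the values on the chain are nonnegative partial sums.\<close>

lemma sect_iff:
  "f \<in> sect \<longleftrightarrow> f \<in> coord_space A \<and> (\<forall>a. 0 \<le> ext f a) \<and> mono (ext f)"
proof -
  have "0 \<le> ext f a" if "\<forall>b\<in>A. 0 \<le> f $ b" for a
  proof (cases "a \<in> A")
    case True
    with that show ?thesis by (simp add: ext_A)
  next
    case False
    then obtain i where i: "i \<in> {1..n}" "a = t i" by auto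
    then show ?thesis using v_nonneg[of i] v_u[of i] by (simp add: ext_t)
  qed
  moreover have "0 \<le> f $ b" if "\<forall>a. 0 \<le> ext f a" "b \<in> A" for b
    using that(1)[rule_format, of b] by (simp only: ext_A[OF that(2)])
  moreover have "mono_on A (\<lambda>b. f $ b)" if "mono (ext f)"
  proof (rule mono_onI)
    fix a b assume "a \<in> A" "b \<in> A" "a \<le> b"
    with monoD[OF that \<open>a \<le> b\<close>] show "f $ a \<le> f $ b" by (simp only: ext_A)
  qed
  ultimately show ?thesis by (auto simp: order_cone_section_def)
qed

lemma polytope_sect: "polytope sect"
proof -
  have "sect = {f \<in> coord_space A. (\<forall>a. 0 \<le> ext f a) \<and> (\<forall>(a, b)\<in>{(a, b). a \<le> b}. ext f a \<le> ext f b)}"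
    by (auto simp: sect_iff mono_def)
  then show ?thesis using polytope_order_maps[of "{(a, b). a \<le> b}"] le_top by simp
qed

lemma polytope_cell:
  assumes "\<pi> \<in> L" shows "polytope (cell \<pi>)"
proof -
  have "cell \<pi> = {f \<in> coord_space A. (\<forall>a. 0 \<le> ext f a) \<and> (\<forall>(a, b)\<in>{(a, b). \<pi> a \<le> \<pi> b}. ext f a \<le> ext f b)}"
    by (auto simp: cell_iff[OF assms])
  moreover have "\<pi> a \<le> \<pi> (t n)" for a
    using le_top assms by (auto simp: linear_extensions_def monoD)
  ultimately show ?thesis using polytope_order_maps[of "{(a, b). \<pi> a \<le> \<pi> b}"] by simp
qed

section \<open>Faces and intersections of cells\<close>

text \<open>An inequality valid on \<open>S\<close> supports \<open>S\<close>, and its equality case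
  is a face.\<close>

lemma face_of_ext_eq:
  assumes "convex S" "\<And>f. f \<in> S \<Longrightarrow> ext f a \<le> ext f b"
  shows "{f \<in> S. ext f a = ext f b} face_of S"
proof -
  obtain c k where a: "\<And>f. ext f a = c \<bullet> f + k" using ext_affine[of a] by blast
  obtain d l where b: "\<And>f. ext f b = d \<bullet> f + l" using ext_affine[of b] by blast
  have "(c - d) \<bullet> f \<le> l - k" if "f \<in> S" for f
    using assms(2)[OF that] by (simp add: a b inner_diff_left)
  then have "S \<inter> {f. (c - d) \<bullet> f = l - k} face_of S"
    by (rule face_of_Int_supporting_hyperplane_le[OF assms(1)])
  moreover have "S \<inter> {f. (c - d) \<bullet> f = l - k} = {f \<in> S. ext f a = ext f b}"
    by (auto simp: a b inner_diff_left)
  ultimately show ?thesis by simp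
qed

lemma cell_Int_face:
  assumes \<pi>: "\<pi> \<in> L" and \<sigma>: "\<sigma> \<in> L"
  shows "cell \<pi> \<inter> cell \<sigma> face_of cell \<pi>"
proof -
  \<comment> \<open>Pairs that the two words order oppositely. Those with \<open>a = b\<close> are
    kept so that the family of faces to be intersected is nonempty.\<close>
  let ?D = "{(a, b). \<pi> a \<le> \<pi> b \<and> \<sigma> b \<le> \<sigma> a}"
  have "cell \<pi> \<inter> cell \<sigma> = (\<Inter>(a, b)\<in>?D. {f \<in> cell \<pi>. ext f a = ext f b})"
  proof (intro equalityI subsetI)
    fix f assume "f \<in> cell \<pi> \<inter> cell \<sigma>"
    then show "f \<in> (\<Inter>(a, b)\<in>?D. {f \<in> cell \<pi>. ext f a = ext f b})"
      by (auto simp: cell_iff[OF \<pi>] cell_iff[OF \<sigma>] intro: antisym)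
  next
    fix f assume f: "f \<in> (\<Inter>(a, b)\<in>?D. {f \<in> cell \<pi>. ext f a = ext f b})"
    have eq: "ext f a = ext f b" if "\<pi> a \<le> \<pi> b" "\<sigma> b \<le> \<sigma> a" for a b
      using f that by auto
    have "(t n, t n) \<in> ?D" by simp
    then have f\<pi>: "f \<in> cell \<pi>" using f by blast
    \<comment> \<open>Either the two words disagree on the pair, and the values coincide, or they
      agree, and membership in the cell of \<open>\<pi>\<close> gives the inequality.\<close>
    have "ext f b \<le> ext f a" if "\<sigma> b \<le> \<sigma> a" for a b
      using eq[OF _ that] f\<pi> by (cases "\<pi> a \<le> \<pi> b") (auto simp: cell_iff[OF \<pi>])
    then show "f \<in> cell \<pi> \<inter> cell \<sigma>"
      using f\<pi> by (auto simp: cell_iff[OF \<pi>] cell_iff[OF \<sigma>])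
  qed
  moreover have "\<dots> face_of cell \<pi>"
  proof (rule face_of_Inter)
    have "(t n, t n) \<in> ?D" by simp
    then show "(\<lambda>(a, b). {f \<in> cell \<pi>. ext f a = ext f b}) ` ?D \<noteq> {}" by blast
    fix T assume "T \<in> (\<lambda>(a, b). {f \<in> cell \<pi>. ext f a = ext f b}) ` ?D"
    then obtain a b where T: "\<pi> a \<le> \<pi> b" "T = {f \<in> cell \<pi>. ext f a = ext f b}" by blast
    show "T face_of cell \<pi>"
      unfolding T(2) using polytope_imp_convex[OF polytope_cell[OF \<pi>]]
      by (rule face_of_ext_eq) (use T(1) in \<open>simp add: cell_iff[OF \<pi>]\<close>)
  qed
  ultimately show ?thesis by simp
qed

text \<open>Sorting the elements by value, and by label among equal values, produces a linear
  extension whose cell contains \<open>f\<close>.\<close>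

lemma Union_cell: "\<Union>(cell ` L) = sect"
proof (intro equalityI subsetI)
  fix f assume "f \<in> \<Union>(cell ` L)"
  then show "f \<in> sect" by (auto simp: Lambda_cell_def)
next
  fix f assume f: "f \<in> sect"
  have \<alpha>: "bij_betw \<alpha> {1..p} UNIV" using labeling by (simp add: natural_labeling_def)
  define lab where "lab = inv_into {1..p} \<alpha>"
  have lab: "lab a \<in> {1..p}" "\<alpha> (lab a) = a" for a
    unfolding lab_def
    using inv_into_into[of a \<alpha> "{1..p}"] f_inv_into_f[of a \<alpha> "{1..p}"] bij_betw_imp_surj_on[OF \<alpha>]
    by simp_all
  have lab_mono: "lab a \<le> lab b" if "a \<le> b" for a b
  proof (cases "a = b")
    case False
    with that have "\<alpha> (lab a) < \<alpha> (lab b)" by (simp add: lab(2))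
    then have "lab a < lab b"
      using labeling lab(1)[of a] lab(1)[of b] unfolding natural_labeling_def by blast
    then show ?thesis by simp
  qed simp
  have lab_inj: "a = b" if "lab a = lab b" for a b
    using arg_cong[OF that, of \<alpha>] by (simp add: lab(2))
  \<comment> \<open>Lexicographic order on value and label; injectivity of the labels makes it
    antisymmetric.\<close>
  define le where "le a b \<longleftrightarrow> ext f a < ext f b \<or> ext f a = ext f b \<and> lab a \<le> lab b" for a b
  obtain \<pi> where \<pi>: "bij_betw \<pi> UNIV {1..p}" "\<And>a b. \<pi> a \<le> \<pi> b \<longleftrightarrow> le a b"
  proof (rule exists_sorting_bijection[of le])
    show "le a b \<or> le b a" for a b by (auto simp: le_def)
    show "le a c" if "le a b" "le b c" for a b c using that by (auto simp: le_def)
    show "a = b" if "le a b" "le b a" for a b using that by (auto simp: le_def intro: lab_inj)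
  qed (use p_eq that in simp)
  \<comment> \<open>Values weakly increase along the poset order and ties are resolved by the
    natural labeling, so the sorting respects the poset.\<close>
  have mono: "\<pi> a \<le> \<pi> b" if "a \<le> b" for a b
    using f lab_mono[OF that] monoD[OF _ that, of "ext f"] by (auto simp: \<pi>(2) le_def sect_iff)
  then have "\<pi> \<in> L"
    using \<pi>(1) by (simp add: linear_extensions_def mono_def)
  moreover have "f \<in> cell \<pi>"
    using f by (auto simp: cell_iff[OF \<open>\<pi> \<in> L\<close>] sect_iff \<pi>(2) le_def)
  ultimately show "f \<in> \<Union>(cell ` L)" by blast
qed

section \<open>The complex of all faces of cells\<close>

definition faces :: "(real^'a::{finite,order}) set set" where
  "faces = (\<Union>\<pi>\<in>L. {F. F face_of cell \<pi>})"

lemma finite_linear_extensions: "finite L"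
proof (rule finite_subset)
  show "L \<subseteq> (UNIV :: 'a set) \<rightarrow>\<^sub>E {1..p}" by (auto simp: linear_extensions_def bij_betw_def)
qed (auto intro: finite_PiE)

lemma cell_in_faces: "\<pi> \<in> L \<Longrightarrow> cell \<pi> \<in> faces"
  unfolding faces_def using face_of_refl[OF polytope_imp_convex[OF polytope_cell]] by blast

text \<open>Closure under faces is transitivity of the face relation, and the intersection property
  for faces is inherited from that of the cells containing them.\<close>

lemma polytopal_subdivision_faces: "polytopal_subdivision faces sect"
  unfolding polytopal_subdivision_def
proof (intro conjI ballI allI impI)
  show "polytope sect" by (rule polytope_sect)
  show "finite faces"
    unfolding faces_def using finite_linear_extensions by (auto intro: finite_polytope_faces polytope_cell)
  show "\<Union>faces = sect"
    unfolding Union_cell[symmetric]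
  proof
    show "\<Union>faces \<subseteq> \<Union>(cell ` L)"
      unfolding faces_def by (auto dest!: face_of_imp_subset)
    show "\<Union>(cell ` L) \<subseteq> \<Union>faces"
      using cell_in_faces by (intro Union_mono) auto
  qed
next
  fix X assume "X \<in> faces"
  then obtain \<pi> where \<pi>: "\<pi> \<in> L" "X face_of cell \<pi>" by (auto simp: faces_def)
  then show "polytope X" using face_of_polytope_polytope[OF polytope_cell] by simp
  show "F \<in> faces" if "F face_of X" for F
    using \<pi> face_of_trans[OF that] by (auto simp: faces_def)
  fix Y assume "Y \<in> faces"
  then obtain \<sigma> where \<sigma>: "\<sigma> \<in> L" "Y face_of cell \<sigma>" by (auto simp: faces_def)
  have "X \<inter> Y face_of X \<and> X \<inter> Y face_of Y"
    using cell_Int_face[OF \<pi>(1) \<sigma>(1)] cell_Int_face[OF \<sigma>(1) \<pi>(1)] \<pi>(2) \<sigma>(2)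
    by (intro face_of_Int_subface[of "cell \<pi>" "cell \<sigma>"]) (simp_all add: Int_commute)
  then show "X \<inter> Y face_of X" "X \<inter> Y face_of Y" by auto
qed

text \<open>Every cell has the full dimension, while a proper face of a convex set has smaller
  dimension; so the full-dimensional faces are the cells themselves.\<close>

lemma chambers_faces: "chambers faces sect = cell ` L"
proof -
  \<comment> \<open>The linear extension supplies a full-dimensional cell inside the section; both
    inclusions below have one at hand.\<close>
  have dim_sect: "aff_dim sect = int (card A)" if "\<pi> \<in> L" for \<pi> :: "'a \<Rightarrow> nat"
  proof (rule antisym)
    show "aff_dim sect \<le> int (card A)"
      using aff_dim_subset[of sect "coord_space A"] by (auto simp: aff_dim_coord_space order_cone_section_def)
    have "cell \<pi> \<subseteq> sect" by (auto simp: Lambda_cell_def)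
    then show "int (card A) \<le> aff_dim sect"
      using aff_dim_subset aff_dim_cell[OF that] by metis
  qed
  show ?thesis
  proof (intro equalityI subsetI)
    fix X assume "X \<in> chambers faces sect"
    then obtain \<pi> where \<pi>: "\<pi> \<in> L" "X face_of cell \<pi>" and "aff_dim X = aff_dim sect"
      by (auto simp: faces_def chambers_def)
    then have "aff_dim X = aff_dim (cell \<pi>)" by (simp add: dim_sect[OF \<pi>(1)] aff_dim_cell)
    then have "X = cell \<pi>"
      using face_of_aff_dim_lt[OF polytope_imp_convex[OF polytope_cell[OF \<pi>(1)]] \<pi>(2)] by auto
    with \<pi>(1) show "X \<in> cell ` L" by blast
  next
    fix X assume "X \<in> cell ` L"
    then obtain \<pi> where \<pi>: "\<pi> \<in> L" "X = cell \<pi>" by blast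
    have "X \<in> faces"
      using \<pi> by (simp add: cell_in_faces)
    then show "X \<in> chambers faces sect"
      using \<pi> by (simp add: chambers_def dim_sect[OF \<pi>(1)] aff_dim_cell)
  qed
qed

end

theorem mainTheorem3:
  fixes p n :: nat
    and \<alpha> t :: "nat \<Rightarrow> 'a::{finite,order}"
    and x u :: "nat \<Rightarrow> real"
  assumes "natural_labeling p \<alpha>"
    and "1 \<le> n"
    and "strict_mono_on {1..n} t"
    and "\<forall>m. (\<forall>y. \<not> m < y) \<longleftrightarrow> m = t n"
    and "\<forall>i\<in>{1..n}. 0 < x i"
    and "\<forall>i\<in>{1..n}. u i = (\<Sum>j=1..i. x j)"
  shows "(\<forall>\<pi>\<in>linear_extensions p.
            product_of_simplices (- t ` {1..n}) n
              (\<lambda>i. height t \<pi> i - height t \<pi> (i - 1) - 1) (Lambda_cell p \<alpha> t n u \<pi>) \<and>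
            coord_volume (- t ` {1..n}) (Lambda_cell p \<alpha> t n u \<pi>) =
              (\<Prod>i=1..n. x i ^ (height t \<pi> i - height t \<pi> (i - 1) - 1) /
                          fact (height t \<pi> i - height t \<pi> (i - 1) - 1))) \<and>
         (\<exists>K. polytopal_subdivision K (order_cone_section t n u) \<and>
              chambers K (order_cone_section t n u) =
                Lambda_cell p \<alpha> t n u ` linear_extensions p)"
proof -
  interpret chain_in_poset p n \<alpha> t x u
    using assms by unfold_locales
  \<comment> \<open>The subdivision \<open>K\<close> is witnessed by \<open>faces\<close>.\<close>
  show ?thesis
    using product_of_simplices_cell coord_volume_cell polytopal_subdivision_faces chambers_faces by blast
qed

end
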